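(* For all $n\ge0$ and $k\ge0$, the number of permutations $\pi\in\mathcal S_n$ with $k$ cycles having no cyclic occurrence of the consecutive pattern 132 and no cyclic occurrence of the consecutive pattern 231 equals the Stirling number of the second kind $S(n,k)$, the number of partitions of $[n]$ into $k$ non-empty blocks.
   Context: $\mathcal S_n$ is the set of permutations of $[n]$. The standard cycle form writes each cycle starting with its smallest element, cycles listed in decreasing order of smallest elements; $\Psi(\pi)$ is the word obtained by deleting parentheses. A cyclic occurrence of the consecutive pattern $\sigma\in\mathcal S_3$ is a position $i$ such that $\Psi(\pi)_i,\Psi(\pi)_{i+1},\Psi(\pi)_{i+2}$ lie in the same cycle and are order-isomorphic to $\sigma$. (Avoiding both 132 and 231 means no three consecutive entries within one cycle form a peak.) *)

theory Defs
  imports "HOL-Combinatorics.Combinatorics" "HOL-Library.Disjoint_Sets"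
begin

text \<open>Permutations of \<open>[n]\<close> are functions \<open>p :: nat \<Rightarrow> nat\<close> with \<open>p permutes {1..n}\<close>.
  Fixed points of \<open>p\<close> inside \<open>{1..n}\<close> count as cycles of length 1.\<close>

definition cycles_of :: "nat \<Rightarrow> (nat \<Rightarrow> nat) \<Rightarrow> nat set set" where
  "cycles_of n p = orbit p ` {1..n}"

text \<open>\<open>support p m\<close> is the list \<open>[m, p m, p (p m), \<dots>]\<close> running once through the cycle of \<open>m\<close>.\<close>

definition standard_cycle_form :: "nat \<Rightarrow> (nat \<Rightarrow> nat) \<Rightarrow> nat list list" where
  "standard_cycle_form n p =
     map (\<lambda>m. support p m) (rev (sorted_list_of_set (Min ` cycles_of n p)))"

definition Psi :: "nat \<Rightarrow> (nat \<Rightarrow> nat) \<Rightarrow> nat list" where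
  "Psi n p = concat (standard_cycle_form n p)"

definition order_isomorphic :: "nat list \<Rightarrow> nat list \<Rightarrow> bool" where
  "order_isomorphic u v \<longleftrightarrow> length u = length v \<and>
     (\<forall>i < length u. \<forall>j < length u. u ! i < u ! j \<longleftrightarrow> v ! i < v ! j)"

text \<open>Patterns are given in one-line notation. Positions in the word are counted from 0, and
  windows do not wrap around, neither in the word nor within a cycle.\<close>

definition cyclic_occurrence :: "nat list \<Rightarrow> nat \<Rightarrow> (nat \<Rightarrow> nat) \<Rightarrow> nat \<Rightarrow> bool" where
  "cyclic_occurrence \<sigma> n p i \<longleftrightarrow>
     i + length \<sigma> \<le> length (Psi n p) \<and>
     (\<exists>C \<in> cycles_of n p. set (take (length \<sigma>) (drop i (Psi n p))) \<subseteq> C) \<and>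
     order_isomorphic (take (length \<sigma>) (drop i (Psi n p))) \<sigma>"

definition cyclically_avoids :: "nat list \<Rightarrow> nat \<Rightarrow> (nat \<Rightarrow> nat) \<Rightarrow> bool" where
  "cyclically_avoids \<sigma> n p \<longleftrightarrow> (\<nexists>i. cyclic_occurrence \<sigma> n p i)"

end

theory Submission
  imports Defs
begin

text \<open>The word of a cycle starts with its smallest element, hence with an ascent; having no peak, it
  never descends afterwards. So the avoiding permutations are those all of whose cycles are written
  in increasing order, and such a permutation is determined by the set partition of
  \<open>[n]\<close> formed by its cycles, which can be arbitrary.\<close>

section \<open>Cycles as the blocks of a partition of [n]\<close>

lemma set_support_eq_orbit:
  assumes "permutation p"
  shows "set (support p a) = orbit p a"
  unfolding support_set[OF assms] orbit_altdef_permutation[OF assms] by blast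

text \<open>The support list runs through the orbit without repetition. The equation makes the
  length of that list depend on the orbit alone, which is how lists of different permutations are
  compared later.\<close>

lemma least_power_eq_card_orbit:
  assumes "permutation p"
  shows "least_power p a = card (orbit p a)"
  using distinct_card[OF cycle_of_permutation[OF assms, of a]]
  unfolding set_support_eq_orbit[OF assms] by simp

lemma orbit_eqI_mem:
  assumes "permutation p" "y \<in> orbit p x"
  shows "orbit p y = orbit p x"
  using assms cyclic_on_orbit' orbit_cyclic_eq3 by metis

lemma permutes_atLeastAtMost_permutation:
  "p permutes {1..n::nat} \<Longrightarrow> permutation p"
  by (auto simp: permutation_permutes)

lemma partition_on_cycles_of:
  assumes "p permutes {1..n}"
  shows "partition_on {1..n} (cycles_of n p)"
proof (rule partition_onI)
  have p: "permutation p" using assms by (rule permutes_atLeastAtMost_permutation)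
  show "\<Union> (cycles_of n p) = {1..n}"
    using permutation_self_in_orbit[OF p] permutes_orbit_subset[OF assms]
    unfolding cycles_of_def by blast
  show "disjnt C D" if "C \<in> cycles_of n p" "D \<in> cycles_of n p" "C \<noteq> D" for C D
    using that orbit_eqI_mem[OF p] unfolding cycles_of_def disjnt_iff by (metis imageE)
  show "{} \<notin> cycles_of n p"
    unfolding cycles_of_def by (metis imageE orbit_nonempty)
qed

lemma cycles_of_block:
  assumes "p permutes {1..n}" "C \<in> cycles_of n p"
  shows "finite C" "C \<noteq> {}" "C \<subseteq> {1..n}" "Min C \<in> C"
    and "x \<in> C \<Longrightarrow> orbit p x = C" and "set (support p (Min C)) = C"
proof -
  have p: "permutation p" using assms(1) by (rule permutes_atLeastAtMost_permutation)
  have P: "partition_on {1..n} (cycles_of n p)" using assms(1) by (rule partition_on_cycles_of)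
  show sub: "C \<subseteq> {1..n}" using partition_onD1[OF P] assms(2) by blast
  then show fin: "finite C" using finite_subset by blast
  show ne: "C \<noteq> {}" using partition_onD3[OF P] assms(2) by blast
  show Min: "Min C \<in> C" using fin ne by simp
  show orb: "orbit p x = C" if "x \<in> C" for x
    using that assms(2) orbit_eqI_mem[OF p] unfolding cycles_of_def by blast
  show "set (support p (Min C)) = C"
    unfolding set_support_eq_orbit[OF p] using Min by (rule orb)
qed

section \<open>The lists of the cycles inside the word \<open>Psi\<close>\<close>

lemma set_standard_cycle_form:
  "set (standard_cycle_form n p) = (\<lambda>C. support p (Min C)) ` cycles_of n p"
  by (simp add: standard_cycle_form_def cycles_of_def image_image)

text \<open>A support list is nonempty and its head is its base point, so different minima give
  different lists.\<close>

lemma distinct_standard_cycle_form: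
  assumes "p permutes {1..n}"
  shows "distinct (standard_cycle_form n p)"
proof -
  have p: "permutation p" using assms by (rule permutes_atLeastAtMost_permutation)
  have "inj (\<lambda>m. support p m)"
  proof (rule injI)
    fix a b assume "support p a = support p b"
    moreover have "hd (support p m) = m" for m
      using least_power_of_permutation(2)[OF p, of m] by (simp add: hd_map)
    ultimately show "a = b" by metis
  qed
  then show ?thesis
    unfolding standard_cycle_form_def distinct_map by (auto intro: inj_on_subset)
qed

text \<open>The list of \<open>C\<close> occurs once in the standard form and the other lists are
  disjoint from \<open>C\<close>. Filtering thus recovers the list of a cycle from the word without
  locating it there.\<close>

lemma filter_Psi:
  assumes "p permutes {1..n}" "C \<in> cycles_of n p"
  shows "filter (\<lambda>x. x \<in> C) (Psi n p) = support p (Min C)"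
proof -
  let ?s = "support p (Min C)"
  have "?s \<in> set (standard_cycle_form n p)"
    using assms(2) by (auto simp: set_standard_cycle_form)
  then obtain us vs where L: "standard_cycle_form n p = us @ ?s # vs"
    by (meson split_list)
  have others: "filter (\<lambda>x. x \<in> C) w = []" if w: "w \<in> set us \<union> set vs" for w
  proof -
    have "w \<noteq> ?s" using distinct_standard_cycle_form[OF assms(1)] w unfolding L by auto
    moreover obtain D where D: "D \<in> cycles_of n p" "w = support p (Min D)"
      using w L set_standard_cycle_form[of n p] by auto
    ultimately have "C \<noteq> D" by auto
    then have "C \<inter> D = {}"
      using partition_onD2[OF partition_on_cycles_of[OF assms(1)]] D(1) assms(2)
      by (auto simp: disjoint_def)
    then show ?thesis
      using cycles_of_block(6)[OF assms(1) D(1)] D(2) by (auto simp: filter_empty_conv)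
  qed
  have "filter (\<lambda>x. x \<in> C) (concat us) = []" "filter (\<lambda>x. x \<in> C) (concat vs) = []"
    using others by (auto simp: filter_empty_conv)
  moreover have "filter (\<lambda>x. x \<in> C) ?s = ?s"
    using cycles_of_block(6)[OF assms] by (intro filter_True) blast
  ultimately show ?thesis unfolding Psi_def L by simp
qed

section \<open>Avoiding peaks versus having increasing cycles\<close>

lemma order_isomorphic_132_iff:
  "order_isomorphic [a, b, c] [1, 3, 2] \<longleftrightarrow> a < c \<and> c < b"
  by (auto simp: order_isomorphic_def numeral_3_eq_3 All_less_Suc)

lemma order_isomorphic_231_iff:
  "order_isomorphic [a, b, c] [2, 3, 1] \<longleftrightarrow> c < a \<and> a < b"
  by (auto simp: order_isomorphic_def numeral_3_eq_3 All_less_Suc)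

text \<open>Ascents propagate: an ascent followed by a descent would be a peak, and distinctness
  excludes equality. The minimality of the head supplies the first ascent.\<close>

lemma strict_sorted_if_no_peak:
  fixes xs :: "nat list"
  assumes "distinct xs" and hd_min: "\<And>x. x \<in> set xs \<Longrightarrow> xs ! 0 \<le> x"
    and no_peak: "\<And>i. i + 2 < length xs \<Longrightarrow> \<not> (xs ! i < xs ! (i + 1) \<and> xs ! (i + 2) < xs ! (i + 1))"
  shows "sorted_wrt (<) xs"
proof -
  have "xs ! i < xs ! Suc i" if "Suc i < length xs" for i
    using that
  proof (induction i)
    case 0
    then have len: "0 < length xs" "1 < length xs" by auto
    then have "xs ! 0 \<le> xs ! 1" using hd_min nth_mem by blast
    moreover have "xs ! 0 \<noteq> xs ! 1"
      using nth_eq_iff_index_eq[OF assms(1) len] by linarith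
    ultimately show ?case by simp
  next
    case (Suc i)
    then have "xs ! Suc i \<noteq> xs ! Suc (Suc i)"
      using assms(1) by (simp add: nth_eq_iff_index_eq)
    with Suc no_peak[of i] show ?case by simp
  qed
  then show ?thesis
    by (simp add: sorted_wrt_iff_nth_Suc_transp[OF transp_on_less])
qed

lemma cyclically_avoids_imp_sorted:
  assumes perm: "p permutes {1..n}" and C: "C \<in> cycles_of n p"
    and avoids: "cyclically_avoids [1, 3, 2] n p" "cyclically_avoids [2, 3, 1] n p"
  shows "support p (Min C) = sorted_list_of_set C"
proof -
  let ?s = "support p (Min C)"
  have p: "permutation p" using perm by (rule permutes_atLeastAtMost_permutation)
  note block = cycles_of_block[OF perm C]
  have dist: "distinct ?s" using p by (rule cycle_of_permutation)
  have "?s \<in> set (standard_cycle_form n p)"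
    using C by (auto simp: set_standard_cycle_form)
  then obtain us vs where "standard_cycle_form n p = us @ ?s # vs"
    by (meson split_list)
  then have Psi: "Psi n p = concat us @ ?s @ concat vs" by (simp add: Psi_def)
  have no_peak: "\<not> (?s ! i < ?s ! (i + 1) \<and> ?s ! (i + 2) < ?s ! (i + 1))"
    if i: "i + 2 < length ?s" for i
  proof
    assume peak: "?s ! i < ?s ! (i + 1) \<and> ?s ! (i + 2) < ?s ! (i + 1)"
    define s where "s = ?s"
    \<comment> \<open>Positions within the cycle are shifted by the total length of the cycles
      written before it.\<close>
    let ?j = "length (concat us) + i"
    have "drop i s = s ! i # s ! (i + 1) # s ! (i + 2) # drop (i + 3) s"
      using i unfolding s_def[symmetric] by (simp add: Cons_nth_drop_Suc numeral_eq_Suc)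
    moreover have "drop ?j (Psi n p) = drop i s @ concat vs"
      using i unfolding Psi s_def[symmetric] by simp
    ultimately have window: "take 3 (drop ?j (Psi n p)) = [s ! i, s ! (i + 1), s ! (i + 2)]"
      by (simp add: numeral_3_eq_3)
    have len: "?j + 3 \<le> length (Psi n p)"
      using i unfolding Psi by simp
    have "set [s ! i, s ! (i + 1), s ! (i + 2)] \<subseteq> C"
      using i nth_mem[of _ s] block(6) unfolding s_def[symmetric] by auto
    then have in_cycle: "\<exists>C\<in>cycles_of n p. set (take 3 (drop ?j (Psi n p))) \<subseteq> C"
      unfolding window using C by blast
    \<comment> \<open>The two outer entries of a peak differ, and which of them is smaller decides
      between 132 and 231.\<close>
    have "s ! i \<noteq> s ! (i + 2)"
      using i dist unfolding s_def[symmetric] by (simp add: nth_eq_iff_index_eq)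
    with peak have "order_isomorphic [s ! i, s ! (i + 1), s ! (i + 2)] [1, 3, 2] \<or>
        order_isomorphic [s ! i, s ! (i + 1), s ! (i + 2)] [2, 3, 1]"
      unfolding order_isomorphic_132_iff order_isomorphic_231_iff s_def[symmetric] by auto
    then have "cyclic_occurrence [1, 3, 2] n p ?j \<or> cyclic_occurrence [2, 3, 1] n p ?j"
      unfolding cyclic_occurrence_def using len in_cycle window
      by (auto simp: eval_nat_numeral)
    then show False using avoids unfolding cyclically_avoids_def by blast
  qed
  have "?s ! 0 = Min C"
    using least_power_of_permutation(2)[OF p, of "Min C"] by simp
  then have "sorted_wrt (<) ?s"
    using block(1,6) by (intro strict_sorted_if_no_peak[OF dist _ no_peak]) auto
  then show ?thesis
    using block(6) by (metis sorted_list_of_set.idem_if_sorted_distinct strict_sorted_iff)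
qed

lemma sorted_imp_cyclically_avoids:
  assumes perm: "p permutes {1..n}"
    and sorted: "\<And>C. C \<in> cycles_of n p \<Longrightarrow> support p (Min C) = sorted_list_of_set C"
    and \<sigma>: "\<sigma> = [1, 3, 2] \<or> \<sigma> = [2, 3, 1]"
  shows "cyclically_avoids \<sigma> n p"
  unfolding cyclically_avoids_def
proof
  assume "\<exists>i. cyclic_occurrence \<sigma> n p i"
  then obtain i C where len: "i + 3 \<le> length (Psi n p)" and C: "C \<in> cycles_of n p"
    and sub: "set (take 3 (drop i (Psi n p))) \<subseteq> C"
    and iso: "order_isomorphic (take 3 (drop i (Psi n p))) \<sigma>"
    using \<sigma> unfolding cyclic_occurrence_def by (auto simp: eval_nat_numeral)
  define w where "w = take 3 (drop i (Psi n p))"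
  have "length w = 3" using len by (simp add: w_def)
  then obtain a b c where w: "w = [a, b, c]"
    by (auto simp: numeral_3_eq_3 length_Suc_conv)
  have "Psi n p = take i (Psi n p) @ w @ drop 3 (drop i (Psi n p))"
    unfolding w_def append_take_drop_id by simp
  \<comment> \<open>Deleting the other cycles from the word leaves the window intact.\<close>
  moreover have "filter (\<lambda>x. x \<in> C) w = w"
    using sub by (intro filter_True) (auto simp: w_def)
  ultimately obtain us vs where "filter (\<lambda>x. x \<in> C) (Psi n p) = us @ w @ vs"
    by (metis filter_append)
  then have "us @ w @ vs = sorted_list_of_set C"
    using filter_Psi[OF perm C] sorted[OF C] by simp
  then have "sorted_wrt (<) (us @ w @ vs)"
    by (simp only: strict_sorted_list_of_set)
  then have "b < c" by (simp add: w sorted_wrt_append)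
  \<comment> \<open>Both patterns end in a descent, which contradicts the increasing list of
    \<open>C\<close>.\<close>
  moreover have "c < b"
    using iso \<sigma> unfolding w_def[symmetric] w
    by (auto simp: order_isomorphic_132_iff order_isomorphic_231_iff simp del: One_nat_def)
  ultimately show False by simp
qed

lemma cyclically_avoids_iff_sorted:
  assumes "p permutes {1..n}"
  shows "cyclically_avoids [1, 3, 2] n p \<and> cyclically_avoids [2, 3, 1] n p \<longleftrightarrow>
    (\<forall>C\<in>cycles_of n p. support p (Min C) = sorted_list_of_set C)"
  using cyclically_avoids_imp_sorted[OF assms] sorted_imp_cyclically_avoids[OF assms] by blast

section \<open>The bijection with set partitions\<close>

lemma increasing_cycles_inj:
  assumes "p permutes {1..n}" "q permutes {1..n}" and eq: "cycles_of n p = cycles_of n q"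
    and "\<And>C. C \<in> cycles_of n p \<Longrightarrow> support p (Min C) = sorted_list_of_set C"
    and "\<And>C. C \<in> cycles_of n q \<Longrightarrow> support q (Min C) = sorted_list_of_set C"
  shows "p = q"
proof
  have p: "permutation p" and q: "permutation q"
    using assms(1,2) by (auto intro: permutes_atLeastAtMost_permutation)
  fix x show "p x = q x"
  proof (cases "x \<in> {1..n}")
    case True
    then obtain C where C: "C \<in> cycles_of n p" "x \<in> C"
      using partition_onD1[OF partition_on_cycles_of[OF assms(1)]] by blast
    \<comment> \<open>On each cycle a permutation can be read off from the list of that cycle, and
      here the list depends only on the set \<open>C\<close>.\<close>
    then have "p x = cycle_of_list (support p (Min C)) x"
      using cycles_of_block(6)[OF assms(1)] by (intro cycle_restrict[OF p]) blast
    also have "support p (Min C) = support q (Min C)"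
      using C eq assms(4,5) by simp
    also have "cycle_of_list \<dots> x = q x"
      using C eq cycles_of_block(6)[OF assms(2)] by (intro cycle_restrict[OF q, symmetric]) blast
    finally show ?thesis .
  next
    case False
    then show ?thesis using assms(1,2) by (metis permutes_not_in)
  qed
qed

text \<open>Applying the \<open>i\<close>-th power to every entry rotates the list by
  \<open>i\<close>; the claim is this fact read off at the head. The bound on \<open>i\<close>
  prevents the index from wrapping around.\<close>

lemma funpow_cycle_of_list:
  assumes "distinct xs" "i < length xs"
  shows "(cycle_of_list xs ^^ i) (xs ! 0) = xs ! i"
proof -
  have "map (cycle_of_list xs ^^ i) xs ! 0 = rotate i xs ! 0"
    using cyclic_rotation[OF assms(1)] by simp
  moreover have "0 < length xs" using assms(2) by linarith
  ultimately show ?thesis using assms(2) by (simp add: nth_rotate)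
qed

text \<open>Iterating from \<open>a\<close> never leaves the orbit, so agreement there suffices.
  This carries facts about a single cycle over to a permutation glued from several cycles.\<close>

lemma support_cong_on_orbit:
  assumes "permutation p" "permutation q" and eq: "\<And>x. x \<in> orbit p a \<Longrightarrow> q x = p x"
  shows "orbit q a = orbit p a" "support q a = support p a"
proof -
  show orb: "orbit q a = orbit p a"
    using permutation_self_in_orbit[OF assms(1)] eq by (rule orbit_cong)
  have pow: "(q ^^ i) a = (p ^^ i) a" for i
  proof (induction i)
    case (Suc i)
    then show ?case
      using eq funpow_in_orbit[OF permutation_self_in_orbit[OF assms(1)]] by simp
  qed simp
  show "support q a = support p a"
    using least_power_eq_card_orbit[OF assms(1), of a]
      least_power_eq_card_orbit[OF assms(2), of a] orb pow by simp
qed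

lemma support_cycle_of_list:
  assumes "distinct xs" "xs \<noteq> []"
  shows "orbit (cycle_of_list xs) (xs ! 0) = set xs" "support (cycle_of_list xs) (xs ! 0) = xs"
proof -
  let ?c = "cycle_of_list xs" let ?m = "xs ! 0"
  have c: "permutation ?c" by (rule permutation_of_cycle)
  \<comment> \<open>Returning after \<open>length xs\<close> steps bounds the powers needed to
    exhaust the orbit, and those powers yield exactly the entries of \<open>xs\<close>.\<close>
  have "(?c ^^ length xs) ?m = ?m" by (simp add: cycle_is_id_root[OF assms(1)])
  then have "orbit ?c ?m = {(?c ^^ i) ?m | i. i < length xs}"
    using assms(2) by (intro orbit_altdef_bounded) auto
  also have "\<dots> = set xs"
    using funpow_cycle_of_list[OF assms(1)] by (auto simp: set_conv_nth) metis
  finally show orb: "orbit ?c ?m = set xs" .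
  have "least_power ?c ?m = length xs"
    unfolding least_power_eq_card_orbit[OF c] orb using assms(1) by (rule distinct_card)
  then show "support ?c ?m = xs"
    using funpow_cycle_of_list[OF assms(1)] by (intro nth_equalityI) auto
qed

lemma increasing_cycles_surj:
  assumes P: "partition_on {1..n} P"
  obtains p where "p permutes {1..n}" "cycles_of n p = P"
    "\<And>C. C \<in> P \<Longrightarrow> support p (Min C) = sorted_list_of_set C"
proof -
  define c where "c C = cycle_of_list (sorted_list_of_set C)" for C :: "nat set"
  \<comment> \<open>Each block is turned into the cycle that lists it in increasing order, and these
    cycles are glued together; \<open>THE\<close> selects the unique block containing
    \<open>x\<close>. Points outside [n] are fixed, as \<open>permutes\<close> demands.\<close>
  define p where "p x = (if x \<in> {1..n} then c (THE C. C \<in> P \<and> x \<in> C) x else x)" for x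
  have block: "finite C" "C \<noteq> {}" "C \<subseteq> {1..n}" if "C \<in> P" for C
    using that partition_onD1[OF P] partition_onD3[OF P] by (auto intro: finite_subset)
  have p_block: "p x = c C x" if "C \<in> P" "x \<in> C" for C x
  proof -
    have "(THE C. C \<in> P \<and> x \<in> C) = C"
      using that partition_onD2[OF P] by (intro the_equality) (auto simp: disjoint_def)
    then show ?thesis using that block[of C] by (auto simp: p_def)
  qed
  \<comment> \<open>Surjectivity on [n] is obtained block by block; injectivity then follows by
    finiteness.\<close>
  have "p ` C = C" if "C \<in> P" for C
    using cycle_is_surj[of "sorted_list_of_set C"] p_block[OF that] block(1)[OF that]
    by (simp add: c_def)
  then have "p ` {1..n} = {1..n}"
    unfolding partition_onD1[OF P] by (simp add: image_Union)
  then have perm: "p permutes {1..n}"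
    by (intro bij_imp_permutes) (auto simp: bij_betw_def p_def intro: eq_card_imp_inj_on)
  then have p: "permutation p" by (rule permutes_atLeastAtMost_permutation)
  have supp: "support p (Min C) = sorted_list_of_set C" "orbit p (Min C) = C" if C: "C \<in> P" for C
  proof -
    have ne: "sorted_list_of_set C \<noteq> []" using block[OF C] by simp
    have "sorted_list_of_set C ! 0 = Min C"
      using block[OF C] by (simp add: sorted_list_of_set_nonempty)
    then have c: "orbit (c C) (Min C) = C" "support (c C) (Min C) = sorted_list_of_set C"
      using support_cycle_of_list[OF _ ne] block(1)[OF C] by (simp_all add: c_def)
    moreover have "permutation (c C)" unfolding c_def by (rule permutation_of_cycle)
    ultimately show "support p (Min C) = sorted_list_of_set C" "orbit p (Min C) = C"
      using support_cong_on_orbit[OF _ p, of "c C" "Min C"] p_block[OF C] by simp_all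
  qed
  \<comment> \<open>\<open>cycles_of\<close> collects the orbits of all points of [n], so the orbit
    of the minimum alone is not enough.\<close>
  have orb: "orbit p x = C" if "C \<in> P" "x \<in> C" for C x
    using orbit_eqI_mem[OF p, of x "Min C"] supp(2)[OF that(1)] that by simp
  have "cycles_of n p = P"
  proof
    show "cycles_of n p \<subseteq> P"
      unfolding cycles_of_def partition_onD1[OF P] using orb by auto
    show "P \<subseteq> cycles_of n p"
    proof
      fix C assume C: "C \<in> P"
      then have "Min C \<in> {1..n}" using block[OF C] Min_in by blast
      with supp(2)[OF C] show "C \<in> cycles_of n p" unfolding cycles_of_def by blast
    qed
  qed
  with perm supp(1) that show thesis by blast
qed

theorem mainTheorem10:
  fixes n k :: nat
  shows "card {p. p permutes {1..n} \<and> card (cycles_of n p) = k \<and>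
                  cyclically_avoids [1, 3, 2] n p \<and> cyclically_avoids [2, 3, 1] n p}
       = card {P. partition_on {1..n} P \<and> card P = k}"
    (is "card ?A = card ?B")
proof -
  have A: "?A = {p. p permutes {1..n} \<and> card (cycles_of n p) = k \<and>
      (\<forall>C\<in>cycles_of n p. support p (Min C) = sorted_list_of_set C)}"
    using cyclically_avoids_iff_sorted by blast
  \<comment> \<open>The set of cycles is itself the partition, so the number of cycles becomes the
    number of blocks.\<close>
  have "bij_betw (cycles_of n) ?A ?B"
    unfolding bij_betw_def
  proof
    show "inj_on (cycles_of n) ?A"
      unfolding A by (rule inj_onI) (blast intro: increasing_cycles_inj)
    show "cycles_of n ` ?A = ?B"
    proof
      show "cycles_of n ` ?A \<subseteq> ?B" using partition_on_cycles_of by blast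
      show "?B \<subseteq> cycles_of n ` ?A"
      proof
        fix P assume "P \<in> ?B"
        then obtain p where "p permutes {1..n}" "cycles_of n p = P" "card P = k"
          "\<And>C. C \<in> P \<Longrightarrow> support p (Min C) = sorted_list_of_set C"
          using increasing_cycles_surj[of n P] by blast
        then show "P \<in> cycles_of n ` ?A" unfolding A by blast
      qed
    qed
  qed
  then show ?thesis by (rule bij_betw_same_card)
qed

end
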